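(* Let $p$ be an odd prime with $p\equiv 3 \pmod 4$ and $p\neq 7$. Then $C_{Q_p,\mathbf 1}=9$.
   Context: For an odd prime $p$, $\mathbb Z_p=\mathbb Z/p\mathbb Z$, $U(p)$ is its group of units, and $Q_p=\{x^2:x\in U(p)\}$. A sequence of length $k$ in $\mathbb Z_p$ is an element of $\mathbb Z_p^k$. A sequence $(x_1,\ldots,x_k)$ in $\mathbb Z_p$ is called a $(Q_p,\mathbf 1)$-weighted zero-sum sequence if there exist $a_1,\ldots,a_k\in Q_p$ such that $a_1x_1+\cdots+a_kx_k=0$ and $a_1+\cdots+a_k=0$ in $\mathbb Z_p$. The constant $C_{Q_p,\mathbf 1}$ is the least positive integer $k$ such that every sequence in $\mathbb Z_p$ of length $k$ has a (non-empty) $(Q_p,\mathbf 1)$-weighted zero-sum subsequence consisting of consecutive terms. *)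

theory Defs
  imports "HOL-Number_Theory.Number_Theory" "HOL-Library.Sublist"
begin

abbreviation Z_mod :: "nat \<Rightarrow> int ring"
  where "Z_mod n \<equiv> residue_ring (int n)"

definition unit_squares :: "nat \<Rightarrow> int set"
  where "unit_squares n = {x [^]\<^bsub>Z_mod n\<^esub> (2::nat) | x. x \<in> Units (Z_mod n)}"

text \<open>
  The weights \<open>a\<^sub>1, \<dots>, a\<^sub>k\<close> are the values of \<open>a\<close> at \<open>0, \<dots>, k - 1\<close>; both sums are taken
  in the ring of residues modulo \<open>n\<close>.
\<close>

definition weighted_zero_sum :: "nat \<Rightarrow> int set \<Rightarrow> int list \<Rightarrow> bool"
  where "weighted_zero_sum n A xs \<longleftrightarrow>
    (\<exists>a. (\<forall>i<length xs. a i \<in> A) \<and>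
      (\<Oplus>\<^bsub>Z_mod n\<^esub>i\<in>{..<length xs}. a i \<otimes>\<^bsub>Z_mod n\<^esub> xs ! i) = \<zero>\<^bsub>Z_mod n\<^esub> \<and>
      (\<Oplus>\<^bsub>Z_mod n\<^esub>i\<in>{..<length xs}. a i) = \<zero>\<^bsub>Z_mod n\<^esub>)"

text \<open>
  The relation \<open>sublist\<close> of the library describes contiguous sublists, that is, subsequences of
  consecutive terms.
\<close>

definition consecutive_constant :: "nat \<Rightarrow> int set \<Rightarrow> nat"
  where "consecutive_constant n A =
    (LEAST k. 0 < k \<and>
      (\<forall>xs. length xs = k \<and> set xs \<subseteq> carrier (Z_mod n) \<longrightarrow>
        (\<exists>ys. sublist ys xs \<and> ys \<noteq> [] \<and> weighted_zero_sum n A ys)))"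

end

theory Submission
  imports Defs
begin

text \<open>
  Since \<open>-1\<close> is a non-residue, no sum of one or two weights vanishes, so \<open>0, 0, 1, 0, 0, 1, 0, 0\<close>
  gives the lower bound. For the upper bound with \<open>p > 7\<close>, the identity \<open>9 + 16 = 25\<close>, whose
  summands are distinct modulo \<open>p\<close> because \<open>p \<noteq> 7\<close>, yields two solutions of \<open>A a + B b = c\<close> in
  squares for all units \<open>A, B, c\<close>. Hence three nonzero terms, not all equal, admit weights that
  annihilate their weighted sum but do not themselves sum to \<open>0\<close>. If every value occurs at most
  twice among nine terms, translate one term to \<open>0\<close> and combine two such groups among the others.
  Otherwise some value occurs three times, and its weights can absorb any sum of the
  remaining weights, unless at most two terms differ from it, in which case three consecutive
  terms are equal. For \<open>p = 3\<close> every weight is \<open>1\<close>, and one applies the pigeonhole principle to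
  the sums of the three blocks of length three.
\<close>

section \<open>Squares modulo a prime congruent to 3 modulo 4\<close>

locale prime_3_mod_4 =
  fixes p :: nat
  assumes prime_p: "prime p" and p_mod_4: "p mod 4 = 3"
begin

abbreviation P :: int
  where "P \<equiv> int p"

definition Q :: "int set"
  where "Q = {a. \<not> P dvd a \<and> QuadRes P a}"

lemma prime_P: "prime P"
  using prime_p by simp

lemma p_gt_2: "2 < p"
  using p_mod_4 prime_ge_2_nat[OF prime_p] by (cases "p = 2") auto

lemma Q_not_dvd: "a \<in> Q \<Longrightarrow> \<not> P dvd a"
  by (simp add: Q_def)

lemma Q_square: "\<not> P dvd x \<Longrightarrow> x\<^sup>2 \<in> Q"
  unfolding Q_def QuadRes_def using prime_dvd_power[OF prime_P] cong_refl by blast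

lemma Q_cong: "a \<in> Q \<Longrightarrow> [a = b] (mod P) \<Longrightarrow> b \<in> Q"
  unfolding Q_def QuadRes_def using cong_dvd_iff cong_trans by blast

lemma Q_mult: "a \<in> Q \<Longrightarrow> b \<in> Q \<Longrightarrow> a * b \<in> Q"
  unfolding Q_def QuadRes_def mem_Collect_eq prime_dvd_mult_iff[OF prime_P]
  using cong_mult power_mult_distrib by metis

lemma one_in_Q: "1 \<in> Q"
  using Q_square[of 1] p_gt_2 by simp

text \<open>Euler's criterion is applied to \<open>a\<close> and \<open>- a\<close>, whose powers
  differ in sign because the exponent \<open>(p - 1) div 2\<close> is odd.\<close>

lemma Legendre_uminus: "[Legendre (- a) P = - Legendre a P] (mod P)"
proof -
  have "odd ((p - 1) div 2)"
    using p_mod_4 by presburger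
  then have "(- a) ^ ((p - 1) div 2) = - (a ^ ((p - 1) div 2))"
    by (simp add: power_minus_odd)
  then have "[- (a ^ ((p - 1) div 2)) = Legendre (- a) P] (mod P)"
    using euler_criterion[OF prime_p p_gt_2, of "- a"] by (simp only: cong_sym)
  moreover have "[- Legendre a P = - (a ^ ((p - 1) div 2))] (mod P)"
    using euler_criterion[OF prime_p p_gt_2, of a] by (simp only: cong_minus_minus_iff)
  ultimately show ?thesis
    using cong_trans cong_sym by blast
qed

lemma uminus_in_Q_iff:
  assumes "\<not> P dvd a"
  shows "- a \<in> Q \<longleftrightarrow> a \<notin> Q"
proof -
  have "\<not> [(1::int) = - 1] (mod P)" "\<not> [- 1 = (1::int)] (mod P)"
    using p_gt_2 by (auto simp: cong_iff_dvd_diff dest: zdvd_imp_le)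
  moreover have "\<not> [a = 0] (mod P)" "\<not> [- a = 0] (mod P)"
    using assms by (auto simp: cong_0_iff)
  ultimately show ?thesis
    using Legendre_uminus[of a] assms by (auto simp: Legendre_def Q_def split: if_splits)
qed

text \<open>A zero sum would make \<open>b\<close> congruent to \<open>- a\<close>, a non-residue.
  This is the obstruction behind the lower bound.\<close>

lemma sum_in_Q_not_dvd: "a \<in> Q \<Longrightarrow> b \<in> Q \<Longrightarrow> \<not> P dvd a + b"
  using uminus_in_Q_iff[of a] Q_cong[of b "- a"] Q_not_dvd
  by (auto simp: cong_iff_dvd_diff add.commute)

text \<open>If the inverse \<open>b\<close> were a non-residue, \<open>- b\<close> would be a
  square, and with it \<open>- (a * b)\<close>, although \<open>a * b\<close> is a square
  already.\<close>

lemma Q_inverse: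
  assumes "a \<in> Q"
  obtains b where "b \<in> Q" and "P dvd a * b - 1"
proof -
  have "coprime a P"
    using Q_not_dvd[OF assms] prime_imp_coprime[OF prime_P] coprime_commute by blast
  then obtain b where b: "[a * b = 1] (mod P)"
    using cong_solve_coprime_int by blast
  then have "a * b \<in> Q"
    using Q_cong one_in_Q cong_sym by blast
  then have "\<not> P dvd b"
    using Q_not_dvd by fastforce
  have "b \<in> Q"
  proof (rule ccontr)
    assume "b \<notin> Q"
    then have "- (a * b) \<in> Q"
      using uminus_in_Q_iff[OF \<open>\<not> P dvd b\<close>] Q_mult[OF assms, of "- b"] by simp
    then show False
      using uminus_in_Q_iff[of "a * b"] \<open>a * b \<in> Q\<close> Q_not_dvd by blast
  qed
  then show thesis
    using that b by (simp add: cong_iff_dvd_diff)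
qed

end

section \<open>Representing units as \<open>A * a + B * b\<close> with squares \<open>a\<close> and
  \<open>b\<close>\<close>

locale prime_3_mod_4_gt_7 = prime_3_mod_4 +
  assumes p_gt_7: "7 < p"
begin

lemma not_dvd_small: "\<not> P dvd 2" "\<not> P dvd 3" "\<not> P dvd 5" "\<not> P dvd 7"
  using p_gt_7 by (auto dest!: zdvd_imp_le)

lemma squares_in_Q: "4 \<in> Q" "9 \<in> Q" "16 \<in> Q" "25 \<in> Q"
  using Q_square[of 2] Q_square[of 3] Q_mult[of 4 4] Q_square[of 5] not_dvd_small by auto

lemma not_dvd_175: "\<not> P dvd 175"
  using prime_dvd_mult_iff[OF prime_P, of 25 7] not_dvd_small Q_not_dvd[OF squares_in_Q(4)] by simp

text \<open>If 2 is a non-residue, \<open>1 + 4\<close> or \<open>1 + 9\<close> works, according to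
  the quadratic character of 5. If 2 is a square, failure would make \<open>Q\<close> closed under
  addition, and then \<open>Q\<close> would contain all positive integers, among them
  \<open>p\<close>.\<close>

lemma nonresidue_sum:
  obtains a b where "a \<in> Q" and "b \<in> Q" and "- (a + b) \<in> Q" and "\<not> P dvd a - b"
proof (cases "2 \<in> Q")
  case False
  then have "- 2 \<in> Q"
    using uminus_in_Q_iff not_dvd_small by blast
  show thesis
  proof (cases "5 \<in> Q")
    case True
    then have "- (1 + 9) \<in> Q"
      using Q_mult[OF \<open>- 2 \<in> Q\<close>, of 5] by simp
    moreover have "\<not> P dvd 1 - 9"
      using prime_dvd_power[OF prime_P, of 2 3] not_dvd_small by auto
    ultimately show thesis
      using that[of 1 9] one_in_Q squares_in_Q by blast
  next
    case False
    then have "- (1 + 4) \<in> Q"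
      using uminus_in_Q_iff[of 5] not_dvd_small by simp
    then show thesis
      using that[of 1 4] one_in_Q squares_in_Q not_dvd_small by simp
  qed
next
  case True
  note distinct_summands = that
  show thesis
  proof (rule ccontr)
    assume none: "\<not> thesis"
    \<comment> \<open>Summands equal modulo \<open>P\<close> add up to 2 times a square, hence to a
      square; for distinct summands the assumed failure applies.\<close>
    have closed: "a + b \<in> Q" if "a \<in> Q" "b \<in> Q" for a b
    proof (cases "P dvd a - b")
      case True
      then have "[2 * a = a + b] (mod P)"
        by (simp add: cong_iff_dvd_diff)
      then show ?thesis
        using Q_cong Q_mult[OF \<open>2 \<in> Q\<close> \<open>a \<in> Q\<close>] by blast
    next
      case False
      then show ?thesis
        using that none distinct_summands uminus_in_Q_iff sum_in_Q_not_dvd by blast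
    qed
    have "int (Suc n) \<in> Q" for n
    proof (induction n)
      case (Suc n)
      then show ?case
        using closed[OF one_in_Q Suc.IH] by simp
    qed (simp add: one_in_Q)
    from this[of "p - 1"] show False
      using Q_not_dvd[of P] p_gt_2 by simp
  qed
qed

text \<open>The second solution makes it possible to avoid a vanishing weight sum in
  \<open>nonzero_weight_sum\<close>.\<close>

definition two_reps :: "int \<Rightarrow> int \<Rightarrow> int \<Rightarrow> bool"
  where "two_reps A B c \<longleftrightarrow> (\<exists>a\<in>Q. \<exists>b\<in>Q. \<exists>a'\<in>Q. \<exists>b'\<in>Q.
    P dvd A * a + B * b - c \<and> P dvd A * a' + B * b' - c \<and> \<not> P dvd a - a')"

lemma two_repsI:
  assumes "a \<in> Q" and "b \<in> Q" and "a' \<in> Q" and "b' \<in> Q" and "P dvd A * a + B * b - c"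
    and "P dvd A * a' + B * b' - c" and "\<not> P dvd a - a'"
  shows "two_reps A B c"
  unfolding two_reps_def using assms by blast

text \<open>Dividing \<open>9 + 16 = 25\<close> by 25, 16 and 9 settles all sign patterns except two
  minus signs, where \<open>nonresidue_sum\<close> supplies the summands. For equal signs, swapping
  the summands gives the second solution.\<close>

lemma two_reps_one:
  assumes "A \<in> {1, - 1}" and "B \<in> {1, - 1}"
  shows "two_reps A B 1"
proof -
  obtain u where u: "u \<in> Q" "P dvd 25 * u - 1"
    by (rule Q_inverse[OF squares_in_Q(4)])
  obtain v where v: "v \<in> Q" "P dvd 16 * v - 1"
    by (rule Q_inverse[OF squares_in_Q(3)])
  obtain w where w: "w \<in> Q" "P dvd 9 * w - 1"
    by (rule Q_inverse[OF squares_in_Q(2)])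
  have "\<not> P dvd 7 * u"
    using prime_dvd_mult_iff[OF prime_P] Q_not_dvd[OF u(1)] not_dvd_small by blast
  then have "two_reps 1 1 1"
    by (intro two_repsI[of "16 * u" "9 * u" "9 * u" "16 * u"] Q_mult squares_in_Q u(1))
      (use u(2) \<open>\<not> P dvd 7 * u\<close> in auto)
  \<comment> \<open>Modulo \<open>P\<close>, \<open>v\<close> and \<open>w\<close> are 1/16 and 1/9,
    and 25/16 - 25/9 = -175/144. Multiplying by -144 leaves 175 = 25 * 7, which \<open>P\<close>
    does not divide.\<close>
  have "False" if "P dvd 25 * v - 25 * w"
  proof -
    have "P dvd (- 144) * (25 * v - 25 * w) + 225 * (16 * v - 1) - 400 * (9 * w - 1)"
      by (rule dvd_diff[OF dvd_add[OF dvd_mult[OF that] dvd_mult[OF v(2)]] dvd_mult[OF w(2)]])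
    then show False
      using not_dvd_175 by (simp add: algebra_simps)
  qed
  then have "two_reps 1 (- 1) 1"
    by (intro two_repsI[of "25 * v" "9 * v" "25 * w" "16 * w"] Q_mult squares_in_Q v(1) w(1))
      (use v(2) w(2) in auto)
  \<comment> \<open>Likewise 9/16 - 16/9 = -175/144.\<close>
  have "False" if "P dvd 9 * v - 16 * w"
  proof -
    have "P dvd (- 144) * (9 * v - 16 * w) + 81 * (16 * v - 1) - 256 * (9 * w - 1)"
      by (rule dvd_diff[OF dvd_add[OF dvd_mult[OF that] dvd_mult[OF v(2)]] dvd_mult[OF w(2)]])
    then show False
      using not_dvd_175 by (simp add: algebra_simps)
  qed
  then have "two_reps (- 1) 1 1"
    by (intro two_repsI[of "9 * v" "25 * v" "16 * w" "25 * w"] Q_mult squares_in_Q v(1) w(1))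
      (use v(2) w(2) in auto)
  obtain a b where ab: "a \<in> Q" "b \<in> Q" "- (a + b) \<in> Q" "\<not> P dvd a - b"
    by (rule nonresidue_sum)
  then obtain t where t: "t \<in> Q" "P dvd - (a + b) * t - 1"
    using Q_inverse by blast
  have "P dvd - 1 * (a * t) + - 1 * (b * t) - 1" "P dvd - 1 * (b * t) + - 1 * (a * t) - 1"
    using t(2) by (simp_all add: algebra_simps)
  moreover have "\<not> P dvd a * t - b * t"
    unfolding left_diff_distrib[symmetric] prime_dvd_mult_iff[OF prime_P]
    using Q_not_dvd[OF t(1)] ab(4) by blast
  ultimately have "two_reps (- 1) (- 1) 1"
    by (intro two_repsI[of "a * t" "b * t" "b * t" "a * t"] Q_mult ab t(1))
  show ?thesis
    using assms \<open>two_reps 1 1 1\<close> \<open>two_reps 1 (- 1) 1\<close> \<open>two_reps (- 1) 1 1\<close>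
      \<open>two_reps (- 1) (- 1) 1\<close> by auto
qed

text \<open>One of \<open>A * c\<close> and \<open>- (A * c)\<close> is a square; dividing it by the
  square of \<open>A\<close> gives \<open>u\<close>.\<close>

lemma scale_to_sign:
  assumes "\<not> P dvd A" and "\<not> P dvd c"
  obtains u e where "u \<in> Q" and "e \<in> {1, - 1 :: int}" and "P dvd A * u - e * c"
proof -
  obtain w where w: "w \<in> Q" "P dvd A\<^sup>2 * w - 1"
    using Q_inverse Q_square[OF assms(1)] by blast
  have "\<not> P dvd A * c"
    using assms prime_P by (simp add: prime_dvd_mult_iff)
  then have "1 * (A * c) \<in> Q \<or> - 1 * (A * c) \<in> Q"
    using uminus_in_Q_iff[of "A * c"] by auto
  then obtain e :: int where e: "e \<in> {1, - 1}" "e * (A * c) \<in> Q"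
    by blast
  have "P dvd (e * c) * (A\<^sup>2 * w - 1)"
    using w(2) by (rule dvd_mult)
  then have "P dvd A * (e * (A * c) * w) - e * c"
    by (simp add: algebra_simps power2_eq_square)
  then show thesis
    using that e Q_mult w by blast
qed

text \<open>Rescaling by the squares \<open>u\<close> and \<open>v\<close> turns the coefficients
  into \<open>e * c\<close> and \<open>f * c\<close>; after cancelling \<open>c\<close> only the
  signs remain.\<close>

lemma two_reps:
  assumes "\<not> P dvd A" and "\<not> P dvd B" and "\<not> P dvd c"
  shows "two_reps A B c"
proof -
  obtain u e where u: "u \<in> Q" "e \<in> {1, - 1}" "P dvd A * u - e * c"
    using scale_to_sign assms by blast
  obtain v f where v: "v \<in> Q" "f \<in> {1, - 1}" "P dvd B * v - f * c"
    using scale_to_sign assms by blast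
  have lift: "P dvd A * (u * a) + B * (v * b) - c" if "P dvd e * a + f * b - 1" for a b
  proof -
    have "P dvd a * (A * u - e * c) + b * (B * v - f * c) + c * (e * a + f * b - 1)"
      by (rule dvd_add[OF dvd_add[OF dvd_mult[OF u(3)] dvd_mult[OF v(3)]] dvd_mult[OF that]])
    then show ?thesis
      by (simp add: algebra_simps)
  qed
  obtain a b a' b' where ab: "a \<in> Q" "b \<in> Q" "a' \<in> Q" "b' \<in> Q"
    "P dvd e * a + f * b - 1" "P dvd e * a' + f * b' - 1" "\<not> P dvd a - a'"
    using two_reps_one[OF u(2) v(2)] unfolding two_reps_def by blast
  have "\<not> P dvd u * a - u * a'"
    unfolding right_diff_distrib[symmetric] prime_dvd_mult_iff[OF prime_P]
    using Q_not_dvd[OF u(1)] ab(7) by blast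
  then show ?thesis
    by (intro two_repsI[of "u * a" "v * b" "u * a'" "v * b'"] Q_mult lift ab(1-6) u(1) v(1))
qed

end

section \<open>Weighted zero-sums over index sets and their translation invariance\<close>

lemma sum_remove2:
  fixes f :: "'i \<Rightarrow> int"
  assumes "finite I" and "j \<in> I" and "k \<in> I" and "j \<noteq> k"
  shows "sum f I = f j + f k + sum f (I - {j, k})"
proof -
  have "sum f I = f j + sum f (I - {j})"
    using assms by (simp add: sum.remove)
  also have "sum f (I - {j}) = f k + sum f (I - {j} - {k})"
    using assms by (intro sum.remove) auto
  also have "I - {j} - {k} = I - {j, k}"
    by auto
  finally show ?thesis
    by simp
qed

lemma three_elements:
  assumes "3 \<le> card A"
  obtains i j k where "i \<in> A" and "j \<in> A" and "k \<in> A" and "i \<noteq> j" and "i \<noteq> k" and "j \<noteq> k"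
proof -
  obtain B where "B \<subseteq> A" and "card B = 3"
    using assms obtain_subset_with_card_n by metis
  then show thesis
    using that unfolding card_3_iff by auto
qed

context prime_3_mod_4
begin

text \<open>Integer divisibility and an arbitrary index set allow sums to be split into groups;
  \<open>weighted_zero_sum_iff\<close> links this to the residue ring.\<close>

definition good :: "'i set \<Rightarrow> ('i \<Rightarrow> int) \<Rightarrow> bool"
  where "good I x \<longleftrightarrow> (\<exists>a. (\<forall>i\<in>I. a i \<in> Q) \<and> P dvd (\<Sum>i\<in>I. a i * x i) \<and> P dvd sum a I)"

text \<open>As the weights sum to 0 modulo \<open>P\<close>, subtracting \<open>v\<close> from every
  term leaves the weighted sum unchanged modulo \<open>P\<close>.\<close>

lemma good_translate:
  assumes "\<And>i. i \<in> I \<Longrightarrow> a i \<in> Q" and "P dvd (\<Sum>i\<in>I. a i * (x i - v))" and "P dvd sum a I"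
  shows "good I x"
proof -
  have "(\<Sum>i\<in>I. a i * x i) = (\<Sum>i\<in>I. a i * (x i - v)) + v * sum a I"
    by (simp add: sum_distrib_left sum_subtractf algebra_simps)
  then show ?thesis
    unfolding good_def using assms by (metis dvd_add dvd_mult)
qed

end

section \<open>Weights for groups of terms, and the case analysis for nine terms\<close>

context prime_3_mod_4_gt_7
begin

text \<open>The candidates 1 and 4 for \<open>b\<close> give values that differ by the unit
  \<open>3 * y\<close>, so at most one of them vanishes.\<close>

lemma adjust_weight:
  assumes "\<not> P dvd y"
  obtains b where "b \<in> Q" and "\<not> P dvd c + b * y"
proof -
  have "\<not> P dvd 3 * y"
    unfolding prime_dvd_mult_iff[OF prime_P] using assms not_dvd_small by blast
  moreover have "3 * y = (c + 4 * y) - (c + 1 * y)"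
    by simp
  ultimately have "\<not> P dvd c + 4 * y \<or> \<not> P dvd c + 1 * y"
    using dvd_diff by metis
  then show thesis
    using that one_in_Q squares_in_Q by blast
qed

text \<open>Indices outside \<open>j\<close>, \<open>k\<close>, \<open>l\<close> get weight 1, and
  the weight at \<open>l\<close> is adjusted so that the contribution \<open>c\<close> of all
  indices but \<open>j\<close> and \<open>k\<close> is a unit. Then \<open>two_reps\<close> finds
  the weights at \<open>j\<close> and \<open>k\<close>.\<close>

lemma two_weightings:
  assumes "finite G" and "j \<in> G" and "k \<in> G" and "l \<in> G" and "j \<noteq> k" and "j \<noteq> l" and "k \<noteq> l"
    and "\<not> P dvd y j" and "\<not> P dvd y k" and "\<not> P dvd y l"
  obtains a a' where "\<forall>i. a i \<in> Q" and "\<forall>i. a' i \<in> Q"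
    and "P dvd (\<Sum>i\<in>G. a i * y i)" and "P dvd (\<Sum>i\<in>G. a' i * y i)"
    and "\<forall>i. i \<notin> {j, k} \<longrightarrow> a i = a' i" and "\<not> P dvd a j - a' j"
proof -
  obtain b where b: "b \<in> Q" "\<not> P dvd (\<Sum>i\<in>G - {j, k} - {l}. y i) + b * y l"
    using adjust_weight[OF assms(10)] by blast
  define c where "c = (\<Sum>i\<in>G - {j, k} - {l}. y i) + b * y l"
  define w where "w s t i = (if i = j then s else if i = k then t else if i = l then b else 1)"
    for s t i
  have c: "(\<Sum>i\<in>G. w s t i * y i) = y j * s + y k * t - (- c)" for s t
  proof -
    have "(\<Sum>i\<in>G - {j, k}. w s t i * y i)
      = w s t l * y l + (\<Sum>i\<in>G - {j, k} - {l}. w s t i * y i)"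
      using assms by (intro sum.remove) auto
    also have "(\<Sum>i\<in>G - {j, k} - {l}. w s t i * y i) = (\<Sum>i\<in>G - {j, k} - {l}. y i)"
      by (intro sum.cong) (auto simp: w_def)
    finally show ?thesis
      using assms sum_remove2[of G j k "\<lambda>i. w s t i * y i"] by (simp add: w_def c_def)
  qed
  have "\<not> P dvd - c"
    using b(2) unfolding c_def dvd_minus_iff .
  then have "two_reps (y j) (y k) (- c)"
    by (rule two_reps[OF assms(8,9)])
  then obtain s t s' t' where st: "s \<in> Q" "t \<in> Q" "s' \<in> Q" "t' \<in> Q"
    "P dvd y j * s + y k * t - (- c)" "P dvd y j * s' + y k * t' - (- c)" "\<not> P dvd s - s'"
    unfolding two_reps_def by blast
  show thesis
  proof (rule that[of "w s t" "w s' t'"])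
    show "\<forall>i. w s t i \<in> Q" "\<forall>i. w s' t' i \<in> Q"
      using st b one_in_Q by (simp_all add: w_def)
  qed (use st(5-7) in \<open>simp_all only: c\<close>, simp_all add: w_def)
qed

text \<open>Two weightings differ only at \<open>j\<close> and \<open>k\<close>, by
  \<open>d\<close>. If both weight sums vanished, so would \<open>d j + d k\<close> and
  \<open>d j * y j + d k * y k\<close>, hence also \<open>d j * (y j - y k)\<close>, a product of
  units.\<close>

lemma nonzero_weight_sum:
  assumes "finite G" and "j \<in> G" and "k \<in> G" and "l \<in> G" and "j \<noteq> k" and "j \<noteq> l" and "k \<noteq> l"
    and "\<not> P dvd y j" and "\<not> P dvd y k" and "\<not> P dvd y l" and "\<not> P dvd y j - y k"
  obtains a where "\<And>i. a i \<in> Q" and "P dvd (\<Sum>i\<in>G. a i * y i)" and "\<not> P dvd sum a G"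
proof -
  obtain a a' where a: "\<forall>i. a i \<in> Q" "\<forall>i. a' i \<in> Q"
    "P dvd (\<Sum>i\<in>G. a i * y i)" "P dvd (\<Sum>i\<in>G. a' i * y i)"
    "\<forall>i. i \<notin> {j, k} \<longrightarrow> a i = a' i" "\<not> P dvd a j - a' j"
    by (rule two_weightings[OF assms(1-10)])
  define d where "d i = a i - a' i" for i
  have d: "sum d (G - {j, k}) = 0" "(\<Sum>i\<in>G - {j, k}. d i * y i) = 0"
    using a(5) by (auto simp: d_def intro!: sum.neutral)
  have "\<not> (P dvd sum a G \<and> P dvd sum a' G)"
  proof
    assume "P dvd sum a G \<and> P dvd sum a' G"
    then have "P dvd sum d G"
      by (simp add: d_def sum_subtractf)
    then have "P dvd d j + d k"
      using sum_remove2[OF assms(1-3,5), of d] d by simp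
    moreover have "P dvd (\<Sum>i\<in>G. d i * y i)"
      using a(3,4) by (simp add: d_def left_diff_distrib sum_subtractf)
    then have "P dvd d j * y j + d k * y k"
      using sum_remove2[OF assms(1-3,5), of "\<lambda>i. d i * y i"] d by simp
    ultimately have "P dvd (d j * y j + d k * y k) - (d j + d k) * y k"
      by (intro dvd_diff dvd_mult2)
    then have "P dvd d j * (y j - y k)"
      by (simp add: algebra_simps)
    then show False
      unfolding prime_dvd_mult_iff[OF prime_P] using a(6) assms(11) by (simp add: d_def)
  qed
  then show thesis
    using that a by blast
qed

text \<open>
  Translating by \<open>x i\<close> removes the index \<open>i\<close> from the first equation, so its weight \<open>1\<close> only
  has to be cancelled in the second one by scaling the weights of the other two groups.
\<close>

lemma good_two_triples:
  assumes "finite I" and "i \<in> I" and "{j, k, l, j', k', l'} \<subseteq> I" and "distinct [j, k, l, j', k', l']"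
    and "\<And>m. m \<in> {j, k, l, j', k', l'} \<Longrightarrow> \<not> P dvd x m - x i"
    and "\<not> P dvd x j - x k" and "\<not> P dvd x j' - x k'"
  shows "good I x"
proof -
  define G where "G = {j, k, l}"
  \<comment> \<open>\<open>H\<close> takes in every index outside \<open>G\<close> and
    \<open>i\<close>, not only \<open>j'\<close>, \<open>k'\<close>, \<open>l'\<close>, so that all
    of \<open>I\<close> receives weights.\<close>
  define H where "H = I - insert i G"
  have i: "i \<notin> {j, k, l, j', k', l'}"
    using assms(5)[of i] by auto
  obtain a where a: "\<And>m. a m \<in> Q" "P dvd (\<Sum>m\<in>G. a m * (x m - x i))" "\<not> P dvd sum a G"
    using nonzero_weight_sum[of G j k l "\<lambda>m. x m - x i"] assms(4-6) by (auto simp: G_def)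
  obtain b where b: "\<And>m. b m \<in> Q" "P dvd (\<Sum>m\<in>H. b m * (x m - x i))" "\<not> P dvd sum b H"
    using nonzero_weight_sum[of H j' k' l' "\<lambda>m. x m - x i"] assms i by (auto simp: G_def H_def)
  have "two_reps (sum a G) (sum b H) (- 1)"
    using two_reps[OF a(3) b(3)] p_gt_2 by simp
  then obtain u v where uv: "u \<in> Q" "v \<in> Q" "P dvd sum a G * u + sum b H * v - (- 1)"
    unfolding two_reps_def by blast
  define w where "w m = (if m = i then 1 else if m \<in> G then u * a m else v * b m)" for m
  have split: "(\<Sum>m\<in>I. w m * f m)
    = f i + (u * (\<Sum>m\<in>G. a m * f m) + v * (\<Sum>m\<in>H. b m * f m))" for f :: "_ \<Rightarrow> int"
  proof -
    have "I = insert i (G \<union> H)" "i \<notin> G \<union> H" "G \<inter> H = {}" "finite G" "finite H"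
      using assms(1-3) i by (auto simp: G_def H_def)
    then have "(\<Sum>m\<in>I. w m * f m)
      = w i * f i + ((\<Sum>m\<in>G. w m * f m) + (\<Sum>m\<in>H. w m * f m))"
      by (simp add: sum.union_disjoint)
    moreover have "(\<Sum>m\<in>G. w m * f m) = u * (\<Sum>m\<in>G. a m * f m)"
      unfolding sum_distrib_left using \<open>i \<notin> G \<union> H\<close>
      by (intro sum.cong) (auto simp: w_def mult.assoc)
    moreover have "(\<Sum>m\<in>H. w m * f m) = v * (\<Sum>m\<in>H. b m * f m)"
      unfolding sum_distrib_left using \<open>i \<notin> G \<union> H\<close> \<open>G \<inter> H = {}\<close>
      by (intro sum.cong) (auto simp: w_def mult.assoc)
    ultimately show ?thesis
      by (simp add: w_def)
  qed
  show ?thesis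
  proof (rule good_translate[of I w])
    show "w m \<in> Q" for m
      using uv a b Q_mult one_in_Q by (simp add: w_def)
    show "P dvd (\<Sum>m\<in>I. w m * (x m - x i))"
      using a(2) b(2) by (simp add: split)
    show "P dvd sum w I"
      using split[of "\<lambda>_. 1"] uv(3) by (simp add: algebra_simps)
  qed
qed

text \<open>Choosing \<open>c\<close> so that \<open>s + c\<close> is a unit leaves an equation for
  \<open>a + b\<close> that \<open>two_reps\<close> solves.\<close>

lemma three_weights:
  obtains a b c where "a \<in> Q" and "b \<in> Q" and "c \<in> Q" and "P dvd a + b + c + s"
proof -
  obtain c where c: "c \<in> Q" "\<not> P dvd s + c * 1"
    using adjust_weight[of 1 s] p_gt_2 by auto
  then have "two_reps 1 1 (- (s + c))"
    using two_reps[of 1 1 "- (s + c)"] p_gt_2 unfolding dvd_minus_iff by simp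
  then obtain a b where "a \<in> Q" "b \<in> Q" "P dvd 1 * a + 1 * b - - (s + c)"
    unfolding two_reps_def by blast
  then show thesis
    using that[of a b c] c(1) by (simp add: algebra_simps)
qed

text \<open>After translation by \<open>x i\<close> all terms vanish, and only the weight sum has to
  be cancelled.\<close>

lemma good_equal_triple:
  assumes "i \<noteq> j" and "i \<noteq> k" and "j \<noteq> k" and "x j = x i" and "x k = x i"
  shows "good {i, j, k} x"
proof -
  obtain a b c where w: "a \<in> Q" "b \<in> Q" "c \<in> Q" "P dvd a + b + c + 0"
    by (rule three_weights)
  show ?thesis
    using assms w
    by (intro good_translate[of _ "\<lambda>m. if m = i then a else if m = j then b else c" _ "x i"])
      (auto simp: add_ac)
qed

text \<open>Translation by \<open>x i\<close> removes the three equal terms from the weighted sum.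
  The other terms annihilate it among themselves, and the free weights at \<open>i\<close>,
  \<open>i'\<close>, \<open>i''\<close> cancel the sum of their weights.\<close>

lemma good_triple_plus_three:
  assumes "finite I" and "{i, i', i''} \<subseteq> I" and "distinct [i, i', i'']"
    and "x i' = x i" and "x i'' = x i" and "{j, k, l} \<subseteq> I" and "distinct [j, k, l]"
    and "\<And>m. m \<in> {j, k, l} \<Longrightarrow> \<not> P dvd x m - x i"
  shows "good I x"
proof -
  define G where "G = I - {i, i', i''}"
  have unit: "\<not> P dvd x j - x i" "\<not> P dvd x k - x i" "\<not> P dvd x l - x i"
    using assms(8) by simp_all
  have ne: "j \<noteq> k" "j \<noteq> l" "k \<noteq> l"
    using assms(7) by simp_all
  have "m \<in> G" if "m \<in> I" "\<not> P dvd x m - x i" for m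
    using that assms(4,5) by (auto simp: G_def)
  then have G: "finite G" "j \<in> G" "k \<in> G" "l \<in> G"
    using unit assms(1,6) by (simp_all add: G_def)
  obtain a a' where a: "\<forall>m. a m \<in> Q" "\<forall>m. a' m \<in> Q"
    "P dvd (\<Sum>m\<in>G. a m * (x m - x i))" "P dvd (\<Sum>m\<in>G. a' m * (x m - x i))"
    "\<forall>m. m \<notin> {j, k} \<longrightarrow> a m = a' m" "\<not> P dvd a j - a' j"
    by (rule two_weightings[where y = "\<lambda>m. x m - x i", OF G ne unit])
  obtain c d e where cde: "c \<in> Q" "d \<in> Q" "e \<in> Q" "P dvd c + d + e + sum a G"
    by (rule three_weights)
  define w where "w m = (if m = i then c else if m = i' then d else if m = i'' then e else a m)" for m
  have split: "(\<Sum>m\<in>I. w m * f m)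
    = c * f i + d * f i' + e * f i'' + (\<Sum>m\<in>G. a m * f m)" for f :: "_ \<Rightarrow> int"
  proof -
    have "(\<Sum>m\<in>I. w m * f m) = (\<Sum>m\<in>G. w m * f m) + (\<Sum>m\<in>{i, i', i''}. w m * f m)"
      unfolding G_def using assms(1,2) by (intro sum.subset_diff)
    moreover have "(\<Sum>m\<in>G. w m * f m) = (\<Sum>m\<in>G. a m * f m)"
      by (intro sum.cong) (auto simp: w_def G_def)
    moreover have "(\<Sum>m\<in>{i, i', i''}. w m * f m) = c * f i + d * f i' + e * f i''"
      using assms(3) by (auto simp: w_def)
    ultimately show ?thesis
      by simp
  qed
  show ?thesis
  proof (rule good_translate[of I w])
    show "w m \<in> Q" for m
      using cde(1-3) a(1) by (simp add: w_def)
    show "P dvd (\<Sum>m\<in>I. w m * (x m - x i))"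
      using a(3) assms(4,5) by (simp add: split)
    show "P dvd sum w I"
      using split[of "\<lambda>_. 1"] cde(4) by simp
  qed
qed

lemma good_among_nine:
  fixes x :: "nat \<Rightarrow> int"
  assumes "\<And>i. i < 9 \<Longrightarrow> x i \<in> {0..<P}"
  shows "good {..<9} x \<or> (\<exists>m\<in>{0, 3, 6}. good {m, Suc m, Suc (Suc m)} x)"
proof -
  have diff: "\<not> P dvd x i - x j" if "i < 9" "j < 9" "x i \<noteq> x j" for i j
    using that assms[of i] assms[of j] mod_eq_dvd_iff[of "x i" P "x j"] by auto
  define E where "E v = {i \<in> {..<9}. x i = v}" for v
  define N where "N v = {i \<in> {..<9}. x i \<noteq> v}" for v
  have fin: "finite (E v)" "finite (N v)" for v
    by (simp_all add: E_def N_def)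
  have "{..<9} = E v \<union> N v" "E v \<inter> N v = {}" for v
    by (auto simp: E_def N_def)
  then have card_E_N: "card (E v) + card (N v) = 9" for v
    using card_Un_disjoint[OF fin, of v] card_lessThan[of 9] by metis
  \<comment> \<open>Outside the second case every \<open>N v\<close> has at least three elements, so
    failure of the first case bounds every \<open>E v\<close> by 2.\<close>
  consider v where "3 \<le> card (E v)" "3 \<le> card (N v)" | v where "card (N v) \<le> 2"
    | "\<And>v. card (E v) \<le> 2"
  proof -
    have "3 \<le> n \<or> n \<le> 2" for n :: nat
      by arith
    then show thesis
      using that by blast
  qed
  then show ?thesis
  proof cases
    case (1 v)
    obtain i i' i'' where i: "i \<in> E v" "i' \<in> E v" "i'' \<in> E v" "i \<noteq> i'" "i \<noteq> i''" "i' \<noteq> i''"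
      using three_elements[OF 1(1)] by metis
    obtain j k l where j: "j \<in> N v" "k \<in> N v" "l \<in> N v" "j \<noteq> k" "j \<noteq> l" "k \<noteq> l"
      using three_elements[OF 1(2)] by metis
    have "\<not> P dvd x m - x i" if "m \<in> {j, k, l}" for m
      using diff[of m i] that i j by (auto simp: E_def N_def)
    then have "good {..<9} x"
      using i j by (intro good_triple_plus_three[of _ i i' i'' x j k l]) (auto simp: E_def N_def)
    then show ?thesis ..
  next
    case (2 v)
    \<comment> \<open>The three blocks are disjoint, so at most two exceptional indices cannot meet
      all of them.\<close>
    have "\<exists>m\<in>{0, 3, 6}. {m, Suc m, Suc (Suc m)} \<inter> N v = {}"
    proof (rule ccontr)
      assume "\<not> ?thesis"
      then have "{0, Suc 0, Suc (Suc 0)} \<inter> N v \<noteq> {}" "{3, Suc 3, Suc (Suc 3)} \<inter> N v \<noteq> {}"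
        "{6, Suc 6, Suc (Suc 6)} \<inter> N v \<noteq> {}"
        by blast+
      then obtain a b c where abc: "a \<in> {0, Suc 0, Suc (Suc 0)} \<inter> N v"
        "b \<in> {3, Suc 3, Suc (Suc 3)} \<inter> N v" "c \<in> {6, Suc 6, Suc (Suc 6)} \<inter> N v"
        unfolding ex_in_conv[symmetric] by (elim exE)
      then have "a < b" "b < c"
        by auto
      then have "card {a, b, c} = 3" "{a, b, c} \<subseteq> N v"
        using abc by auto
      then show False
        using 2 card_mono[OF fin(2), of "{a, b, c}" v] by linarith
    qed
    then obtain m where m: "m \<in> {0, 3, 6}" "{m, Suc m, Suc (Suc m)} \<inter> N v = {}"
      by blast
    then have "x m = v" "x (Suc m) = v" "x (Suc (Suc m)) = v"
      by (auto simp: N_def)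
    then have "good {m, Suc m, Suc (Suc m)} x"
      by (intro good_equal_triple) auto
    then show ?thesis
      using m(1) by blast
  next
    case 3
    have pick: "\<exists>a\<in>A. a \<notin> B" if "card B < card A" "finite B" for A B :: "nat set"
      using that card_mono by (metis not_le subsetI)
    have large: "7 \<le> card (N v)" for v
      using 3[of v] card_E_N[of v] by simp
    \<comment> \<open>The term \<open>x 0\<close> is translated to 0, and \<open>S\<close> collects
      the indices whose terms stay nonzero. Each of the following choices avoids at most four
      indices, while \<open>S\<close> has at least seven.\<close>
    define S where "S = N (x 0)"
    have S: "7 \<le> card S" "finite S" "S \<subseteq> {..<9}"
      using large fin by (auto simp: S_def N_def)
    obtain j where j: "j \<in> S"
      using S by fastforce
    obtain k where k: "k \<in> S" "k \<notin> E (x j)"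
      using pick[of "E (x j)" S] 3[of "x j"] S fin by force
    obtain j' where j': "j' \<in> S" "j' \<notin> {j, k}"
      using pick[of "{j, k}" S] S card_insert_le_m1[of 2 "{k}" j] by fastforce
    obtain k' where k': "k' \<in> S" "k' \<notin> E (x j') \<union> {j, k}"
    proof -
      have "card (E (x j') \<union> {j, k}) \<le> card (E (x j')) + card {j, k}"
        by (rule card_Un_le)
      also have "\<dots> < card S"
        using 3[of "x j'"] S card_insert_le_m1[of 2 "{k}" j] by simp
      finally show thesis
        using pick[of "E (x j') \<union> {j, k}" S] fin that by auto
    qed
    define T where "T = {j, k, j', k'}"
    have "card T \<le> 4"
      unfolding T_def using card_length[of "[j, k, j', k']"] by simp
    then have "3 \<le> card (S - T)"
      using S diff_card_le_card_Diff[of T S] by (simp add: T_def)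
    then obtain l l' where l: "l \<in> S - T" "l' \<in> S - T" "l \<noteq> l'"
      using three_elements by metis
    have six: "{j, k, l, j', k', l'} \<subseteq> S"
      using j k j' k' l by auto
    have "x j \<noteq> x k" "x j' \<noteq> x k'"
      using k k' S(3) by (auto simp: E_def)
    moreover have "distinct [j, k, l, j', k', l']"
      using calculation j' k' l by (auto simp: T_def)
    moreover have "\<not> P dvd x m - x 0" if "m \<in> S" for m
      using diff[of m 0] that by (simp add: S_def N_def)
    ultimately have "good {..<9} x"
      using six S(3) diff[of j k] diff[of j' k']
      by (intro good_two_triples[of _ 0 j k l j' k' l']) auto
    then show ?thesis ..
  qed
qed

end

section \<open>Passage to the residue ring, and the lower bound\<close>

context prime_3_mod_4
begin

lemma residues_P: "residues P"
  using p_gt_2 by unfold_locales simp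

interpretation R: residues P "Z_mod p"
  by (rule residues_P) simp

lemma unit_squares_subset:
  assumes "a \<in> unit_squares p"
  shows "a \<in> Q" and "a mod P = a"
proof -
  obtain x where x: "x \<in> Units (Z_mod p)" "a = x [^]\<^bsub>Z_mod p\<^esub> (2::nat)"
    using assms unfolding unit_squares_def by blast
  then have bounds: "0 < x" "x < P"
    by (simp_all add: R.res_units_eq)
  then have a: "a = x\<^sup>2 mod P"
    using x(2) R.pow_cong[of x 2] by simp
  have "x\<^sup>2 \<in> Q"
    using Q_square bounds by (simp add: zdvd_not_zless)
  then show "a \<in> Q"
    by (rule Q_cong) (simp add: a cong_def)
  show "a mod P = a"
    by (simp add: a)
qed

lemma mod_in_unit_squares:
  assumes "a \<in> Q"
  shows "a mod P \<in> unit_squares p"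
proof -
  obtain y where y: "[y\<^sup>2 = a] (mod P)"
    using assms unfolding Q_def QuadRes_def by blast
  have "\<not> P dvd y"
    using cong_dvd_iff[OF y] Q_not_dvd[OF assms] dvd_mult[of P y y]
    unfolding power2_eq_square by blast
  then have "coprime y P"
    using prime_imp_coprime[OF prime_P] coprime_commute by blast
  then have "y mod P \<in> Units (Z_mod p)"
    using R.mod_in_res_units R.m_gt_one by blast
  moreover have "a mod P = (y mod P) [^]\<^bsub>Z_mod p\<^esub> (2::nat)"
    using y by (simp add: R.pow_cong cong_def)
  ultimately show ?thesis
    unfolding unit_squares_def by blast
qed

text \<open>Reduction modulo \<open>P\<close> maps \<open>Q\<close> into
  \<open>unit_squares p\<close>, whose elements lie in \<open>Q\<close> and are their own residues;
  ring sums are integer sums reduced modulo \<open>P\<close>.\<close>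

lemma weighted_zero_sum_iff:
  "weighted_zero_sum p (unit_squares p) xs \<longleftrightarrow> good {..<length xs} (nth xs)"
proof
  let ?I = "{..<length xs}"
  assume "weighted_zero_sum p (unit_squares p) xs"
  then obtain a where a: "\<And>i. i \<in> ?I \<Longrightarrow> a i \<in> unit_squares p"
    and sums: "(\<Oplus>\<^bsub>Z_mod p\<^esub>i\<in>?I. a i \<otimes>\<^bsub>Z_mod p\<^esub> xs ! i) = \<zero>\<^bsub>Z_mod p\<^esub>"
      "(\<Oplus>\<^bsub>Z_mod p\<^esub>i\<in>?I. a i) = \<zero>\<^bsub>Z_mod p\<^esub>"
    unfolding weighted_zero_sum_def by auto
  \<comment> \<open>\<open>R.sum_cong\<close> speaks of sums of residues, so each weight is first
    rewritten as its own residue.\<close>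
  have "(\<Oplus>\<^bsub>Z_mod p\<^esub>i\<in>?I. a i) = (\<Oplus>\<^bsub>Z_mod p\<^esub>i\<in>?I. a i mod P)"
    using a unit_squares_subset(2) by (intro R.finsum_cong') auto
  then have "P dvd sum a ?I"
    using sums(2) R.sum_cong[of ?I a] by (simp add: R.zero_cong dvd_eq_mod_eq_0)
  moreover have "P dvd (\<Sum>i\<in>?I. a i * xs ! i)"
    using sums(1) R.sum_cong[of ?I "\<lambda>i. a i * xs ! i"]
    by (simp add: R.res_mult_eq R.zero_cong dvd_eq_mod_eq_0)
  ultimately show "good ?I (nth xs)"
    unfolding good_def using a unit_squares_subset(1) by blast
next
  let ?I = "{..<length xs}"
  assume "good ?I (nth xs)"
  then obtain a where a: "\<And>i. i \<in> ?I \<Longrightarrow> a i \<in> Q"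
    and sums: "P dvd (\<Sum>i\<in>?I. a i * xs ! i)" "P dvd sum a ?I"
    unfolding good_def by blast
  have "(\<Oplus>\<^bsub>Z_mod p\<^esub>i\<in>?I. a i mod P) = \<zero>\<^bsub>Z_mod p\<^esub>"
    using sums(2) R.sum_cong[of ?I a] by (simp add: R.zero_cong dvd_eq_mod_eq_0)
  moreover have "(\<Oplus>\<^bsub>Z_mod p\<^esub>i\<in>?I. (a i mod P) \<otimes>\<^bsub>Z_mod p\<^esub> xs ! i) = \<zero>\<^bsub>Z_mod p\<^esub>"
    using sums(1) R.sum_cong[of ?I "\<lambda>i. a i * xs ! i"]
    by (simp add: R.res_mult_eq R.zero_cong dvd_eq_mod_eq_0 mod_mult_left_eq)
  ultimately show "weighted_zero_sum p (unit_squares p) xs"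
    unfolding weighted_zero_sum_def using a mod_in_unit_squares
    by (intro exI[of _ "\<lambda>i. a i mod P"]) auto
qed

text \<open>Shifting by \<open>m\<close> identifies a block of indices with the positions in
  \<open>take k (drop m xs)\<close>.\<close>

lemma weighted_zero_sum_consecutive:
  assumes "good {m..<m + k} (nth xs)" and "0 < k" and "m + k \<le> length xs"
  shows "\<exists>ys. sublist ys xs \<and> ys \<noteq> [] \<and> weighted_zero_sum p (unit_squares p) ys"
proof -
  define ys where "ys = take k (drop m xs)"
  have ys: "length ys = k" "ys ! i = xs ! (i + m)" if "i < k" for i
    using assms(3) that by (simp_all add: ys_def add.commute)
  have shift: "(\<Sum>i\<in>{m..<m + k}. f i) = (\<Sum>i\<in>{..<k}. f (i + m))" for f :: "nat \<Rightarrow> int"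
    by (rule sum.reindex_bij_witness[of _ "\<lambda>i. i + m" "\<lambda>i. i - m"]) auto
  obtain a where a: "\<And>i. i \<in> {m..<m + k} \<Longrightarrow> a i \<in> Q"
    and sums: "P dvd (\<Sum>i\<in>{m..<m + k}. a i * xs ! i)" "P dvd sum a {m..<m + k}"
    using assms(1) unfolding good_def by blast
  have "length ys = k"
    using ys(1) assms(2) by blast
  moreover have "good {..<k} (nth ys)"
    unfolding good_def
  proof (intro exI conjI ballI)
    show "a (i + m) \<in> Q" if "i \<in> {..<k}" for i
      using a that by simp
    show "P dvd (\<Sum>i<k. a (i + m) * ys ! i)"
      using sums(1) ys(2) by (simp add: shift)
    show "P dvd (\<Sum>i<k. a (i + m))"
      using sums(2) by (simp add: shift)
  qed
  moreover have "sublist ys xs"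
    unfolding ys_def using sublist_take sublist_drop sublist_order.order.trans by blast
  moreover have "ys \<noteq> []"
    using assms(2) \<open>length ys = k\<close> by auto
  ultimately show ?thesis
    unfolding weighted_zero_sum_iff by blast
qed

text \<open>A contiguous sublist without a 1 has at most two entries, so its weight sum has one or
  two summands. Any other one contains one or two 1s, and its weighted sum is the sum of that many
  weights. Neither can vanish.\<close>

lemma not_weighted_zero_sum_extremal:
  assumes "sublist ys [0, 0, 1, 0, 0, 1, 0, 0]" and "ys \<noteq> []"
  shows "\<not> weighted_zero_sum p (unit_squares p) ys"
proof
  assume "weighted_zero_sum p (unit_squares p) ys"
  then obtain a where a: "\<And>i. i < length ys \<Longrightarrow> a i \<in> Q"
    and sums: "P dvd (\<Sum>i<length ys. a i * ys ! i)" "P dvd (\<Sum>i<length ys. a i)"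
    unfolding weighted_zero_sum_iff good_def by auto
  have one: "\<not> P dvd a i" if "i < length ys" for i
    using a[OF that] by (rule Q_not_dvd)
  have two: "\<not> P dvd a i + a j" if "i < length ys" "j < length ys" for i j
    using a[OF that(1)] a[OF that(2)] by (rule sum_in_Q_not_dvd)
  \<comment> \<open>Membership in \<open>sublists\<close> reduces the claim to a finite
    enumeration.\<close>
  have "ys \<in> set (sublists [0, 0, 1, 0, 0, 1, 0, 0])"
    using assms(1) by (simp only: in_set_sublists)
  then show False
    unfolding sublists.simps
    using assms(2) sums one two by (auto simp: lessThan_Suc add_ac simp del: in_set_sublists)
qed

lemma good_unit_weights:
  assumes "P dvd (\<Sum>i\<in>I. x i)" and "P dvd int (card I)"
  shows "good I x"
  unfolding good_def using assms one_in_Q by (intro exI[of _ "\<lambda>_. 1"]) simp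

end

section \<open>Upper bounds and the value of the constant\<close>

lemma consecutive_weighted_zero_sum_3:
  assumes "length xs = 9"
  shows "\<exists>ys. sublist ys xs \<and> ys \<noteq> [] \<and> weighted_zero_sum 3 (unit_squares 3) ys"
proof -
  interpret prime_3_mod_4 3
    by unfold_locales simp_all
  define s where "s m k = (\<Sum>i\<in>{m..<m + k}. xs ! i)" for m k
  \<comment> \<open>With all weights equal to 1 the weight sum is the length \<open>k\<close>, hence
    the condition \<open>3 dvd k\<close>.\<close>
  have block: ?thesis if "3 dvd s m k" "3 dvd k" "0 < k" "m + k \<le> 9" for m k
    using that assms int_dvd_int_iff[of 3 k]
    by (intro weighted_zero_sum_consecutive[of m k] good_unit_weights) (simp_all add: s_def)
  have s: "s m (k + l) = s m k + s (m + k) l" for m k l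
    by (simp add: s_def sum.atLeastLessThan_concat add.assoc[symmetric])
  \<comment> \<open>Two of the four prefix sums \<open>0\<close>, \<open>a\<close>,
    \<open>a + b\<close>, \<open>a + b + c\<close> agree modulo 3.\<close>
  have "3 dvd a \<or> 3 dvd b \<or> 3 dvd c \<or> 3 dvd a + b \<or> 3 dvd b + c \<or> 3 dvd a + b + c" for a b c :: int
    by presburger
  from this[of "s 0 3" "s 3 3" "s 6 3"] show ?thesis
    using block[of 0 3] block[of 3 3] block[of 6 3] block[of 0 6] block[of 3 6] block[of 0 9]
      s[of 0 3 3] s[of 3 3 3] s[of 0 6 3] by auto
qed

lemma (in prime_3_mod_4_gt_7) consecutive_weighted_zero_sum:
  assumes "length xs = 9" and "set xs \<subseteq> carrier (Z_mod p)"
  shows "\<exists>ys. sublist ys xs \<and> ys \<noteq> [] \<and> weighted_zero_sum p (unit_squares p) ys"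
proof -
  interpret R: residues P "Z_mod p"
    by (rule residues_P) simp
  have "xs ! i \<in> {0..<P}" if "i < 9" for i
    using subsetD[OF assms(2) nth_mem, of i] assms(1) that by (simp add: R.res_carrier_eq)
  \<comment> \<open>The form \<open>0 + 9\<close> matches \<open>{m..<m + k}\<close> in
    \<open>weighted_zero_sum_consecutive\<close>.\<close>
  then have "good {0..<0 + 9} (nth xs) \<or> (\<exists>m\<in>{0, 3, 6}. good {m, Suc m, Suc (Suc m)} (nth xs))"
    using good_among_nine[of "nth xs"] by (simp add: lessThan_atLeast0)
  moreover have "{m, Suc m, Suc (Suc m)} = {m..<m + 3}" for m
    by auto
  ultimately have "good {0..<0 + 9} (nth xs) \<or> (\<exists>m\<in>{0, 3, 6}. good {m..<m + 3} (nth xs))"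
    by (simp only:)
  then consider "good {0..<0 + 9} (nth xs)"
    | m where "m \<in> {0, 3, 6}" "good {m..<m + 3} (nth xs)"
    by blast
  then show ?thesis
  proof cases
    case 1
    show ?thesis
      using assms(1) by (intro weighted_zero_sum_consecutive[OF 1]) simp_all
  next
    case (2 m)
    then show ?thesis
      using assms(1) by (intro weighted_zero_sum_consecutive[of m 3]) auto
  qed
qed

theorem theorem3p10:
  fixes p :: nat
  assumes "prime p" and "odd p" and "[p = 3] (mod 4)" and "p \<noteq> 7"
  shows "consecutive_constant p (unit_squares p) = 9"
  unfolding consecutive_constant_def
proof (rule Least_equality)
  interpret prime_3_mod_4 p
    using assms by unfold_locales (simp_all add: cong_def)
  have "p = 3 \<or> 7 < p"
    using p_mod_4 assms(4) by presburger
  then show "0 < (9::nat) \<and> (\<forall>xs. length xs = 9 \<and> set xs \<subseteq> carrier (Z_mod p) \<longrightarrow>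
      (\<exists>ys. sublist ys xs \<and> ys \<noteq> [] \<and> weighted_zero_sum p (unit_squares p) ys))"
  proof
    assume "p = 3"
    then show ?thesis
      using consecutive_weighted_zero_sum_3 by simp
  next
    assume "7 < p"
    then interpret prime_3_mod_4_gt_7 p
      by unfold_locales
    show ?thesis
      using consecutive_weighted_zero_sum by simp
  qed
next
  fix k
  interpret prime_3_mod_4 p
    using assms by unfold_locales (simp_all add: cong_def)
  interpret R: residues P "Z_mod p"
    by (rule residues_P) simp
  assume k: "0 < k \<and> (\<forall>xs. length xs = k \<and> set xs \<subseteq> carrier (Z_mod p) \<longrightarrow>
      (\<exists>ys. sublist ys xs \<and> ys \<noteq> [] \<and> weighted_zero_sum p (unit_squares p) ys))"
  show "9 \<le> k"
  proof (rule ccontr)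
    \<comment> \<open>Prefixes of this sequence of length 8 refute every smaller \<open>k\<close> at
      once, since a contiguous sublist of a prefix is one of the whole.\<close>
    let ?w = "[0, 0, 1, 0, 0, 1, 0, 0] :: int list"
    assume "\<not> 9 \<le> k"
    then have "length (take k ?w) = k"
      by simp
    moreover have "set (take k ?w) \<subseteq> carrier (Z_mod p)"
      using set_take_subset[of k ?w] p_gt_2 by (auto simp: R.res_carrier_eq)
    ultimately obtain ys where ys: "sublist ys (take k ?w)" "ys \<noteq> []"
      "weighted_zero_sum p (unit_squares p) ys"
      using k by blast
    have "sublist ys ?w"
      using ys(1) sublist_take by (rule sublist_order.order.trans)
    then show False
      using not_weighted_zero_sum_extremal ys(2,3) by blast
  qed
qed

end
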